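(* Let $G$ be an $(H_1,H_2,C_6)$-free graph and let $S$ be an $S(G)$-set. Then $G$ is a $(\gamma_t,2\gamma)$-graph if and only if $S$ is both a packing and a dominating set of $G$.
   Context: All graphs are finite, simple and have nonempty vertex set. $N(v)$ is the set of vertices adjacent to $v$, $N[v]=N(v)\cup\{v\}$, and for $S\subseteq V(G)$, $N(S)=\bigcup_{v\in S}N(v)$ and $N[S]=N(S)\cup S$. Domination: $S\subseteq V(G)$ is a dominating set if $N[S]=V(G)$; $\gamma(G)$ is the minimum cardinality of a dominating set. If $G$ has no isolated vertices, $S$ is a total dominating set if $N(S)=V(G)$, and $\gamma_t(G)$ is the minimum cardinality of a total dominating set. A $(\gamma_t,2\gamma)$-graph is a graph $G$ with no isolated vertices such that $\gamma_t(G)=2\gamma(G)$. A set $S\subseteq V(G)$ is a packing if $N[u]\cap N[v]=\emptyset$ for all distinct $u,v\in S$. Special vertices: two vertices $u,v$ are true twins if $N[u]=N[v]$. For each vertex $v$, $N[v]$ is partitioned into $T(v)$, consisting of $v$ and all its true twins; $D(v)=\{u\in N(v): N[u]\subsetneq N[v]\}$; and $M(v)=\{u\in N(v): u \text{ has a neighbor } w \text{ with } w\notin N[v]\}$. A non-isolated vertex $v$ is special if there is no $u\in M(v)$ with $D(v)\subseteq N(u)$; isolated vertices are declared not special. True twins of special vertices are special. An $S(G)$-set is a set obtained by choosing exactly one vertex from each class of the partition of the set of special vertices of $G$ under the true twin equivalence relation ($N[u]=N[v]$). Forbidden graphs: a graph is $(G_1,\dots,G_k)$-free if it contains none of $G_1,\dots,G_k$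 as an induced subgraph. $C_k$ is the cycle of length $k$. $H_1$ is the graph on vertices $a_1,\dots,a_6$ with edges $a_1a_2,a_2a_3,a_3a_4,a_4a_5,a_5a_6,a_6a_1$ and $a_2a_6$. $H_2$ is $H_1$ together with the additional edge $a_3a_5$. *)

theory Defs
  imports "Graph_Theory.Pair_Digraph" "Graph_Theory.Digraph_Isomorphism"
begin

text \<open>
  A finite simple graph is a \<^locale>\<open>pair_graph\<close>: a finite set of vertices together with a
  symmetric irreflexive set of arcs, so that an edge \<open>uv\<close> is the pair of arcs
  \<open>(u, v)\<close> and \<open>(v, u)\<close>.
\<close>

subsection \<open>Neighbourhoods and domination\<close>

definition nbhd :: "'a pair_pre_digraph \<Rightarrow> 'a \<Rightarrow> 'a set" where
  "nbhd G v = {u. (v, u) \<in> parcs G}"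

definition closed_nbhd :: "'a pair_pre_digraph \<Rightarrow> 'a \<Rightarrow> 'a set" where
  "closed_nbhd G v = nbhd G v \<union> {v}"

definition set_nbhd :: "'a pair_pre_digraph \<Rightarrow> 'a set \<Rightarrow> 'a set" where
  "set_nbhd G S = (\<Union>v\<in>S. nbhd G v)"

definition closed_set_nbhd :: "'a pair_pre_digraph \<Rightarrow> 'a set \<Rightarrow> 'a set" where
  "closed_set_nbhd G S = set_nbhd G S \<union> S"

definition isolated :: "'a pair_pre_digraph \<Rightarrow> 'a \<Rightarrow> bool" where
  "isolated G v \<longleftrightarrow> v \<in> pverts G \<and> nbhd G v = {}"

definition dominating_set :: "'a pair_pre_digraph \<Rightarrow> 'a set \<Rightarrow> bool" where
  "dominating_set G S \<longleftrightarrow> S \<subseteq> pverts G \<and> closed_set_nbhd G S = pverts G"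

definition total_dominating_set :: "'a pair_pre_digraph \<Rightarrow> 'a set \<Rightarrow> bool" where
  "total_dominating_set G S \<longleftrightarrow> S \<subseteq> pverts G \<and> set_nbhd G S = pverts G"

definition domination_number :: "'a pair_pre_digraph \<Rightarrow> nat" where
  "domination_number G = (LEAST k. \<exists>S. dominating_set G S \<and> card S = k)"

text \<open>If \<open>G\<close> has an isolated vertex there is no total dominating set, and the value of
  the following is irrelevant.\<close>

definition total_domination_number :: "'a pair_pre_digraph \<Rightarrow> nat" where
  "total_domination_number G = (LEAST k. \<exists>S. total_dominating_set G S \<and> card S = k)"

text \<open>The \<open>(\<gamma>\<^sub>t, 2\<gamma>)\<close>-graphs.\<close>

definition gammat_2gamma_graph :: "'a pair_pre_digraph \<Rightarrow> bool" where
  "gammat_2gamma_graph G \<longleftrightarrow>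
     (\<nexists>v. isolated G v) \<and> total_domination_number G = 2 * domination_number G"

definition packing :: "'a pair_pre_digraph \<Rightarrow> 'a set \<Rightarrow> bool" where
  "packing G S \<longleftrightarrow> S \<subseteq> pverts G \<and>
     (\<forall>u\<in>S. \<forall>v\<in>S. u \<noteq> v \<longrightarrow> closed_nbhd G u \<inter> closed_nbhd G v = {})"

subsection \<open>Special vertices\<close>

definition true_twins :: "'a pair_pre_digraph \<Rightarrow> 'a \<Rightarrow> 'a \<Rightarrow> bool" where
  "true_twins G u v \<longleftrightarrow> closed_nbhd G u = closed_nbhd G v"

definition D_set :: "'a pair_pre_digraph \<Rightarrow> 'a \<Rightarrow> 'a set" where
  "D_set G v = {u \<in> nbhd G v. closed_nbhd G u \<subset> closed_nbhd G v}"

definition M_set :: "'a pair_pre_digraph \<Rightarrow> 'a \<Rightarrow> 'a set" where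
  "M_set G v = {u \<in> nbhd G v. \<exists>w \<in> nbhd G u. w \<notin> closed_nbhd G v}"

definition special :: "'a pair_pre_digraph \<Rightarrow> 'a \<Rightarrow> bool" where
  "special G v \<longleftrightarrow> v \<in> pverts G \<and> \<not> isolated G v \<and>
     (\<nexists>u. u \<in> M_set G v \<and> D_set G v \<subseteq> nbhd G u)"

definition special_twin_rel :: "'a pair_pre_digraph \<Rightarrow> 'a rel" where
  "special_twin_rel G = {(u, v). special G u \<and> special G v \<and> true_twins G u v}"

text \<open>The \<open>S(G)\<close>-sets: transversals of the partition of the special vertices into
  true twin classes.\<close>

definition S_set :: "'a pair_pre_digraph \<Rightarrow> 'a set \<Rightarrow> bool" where
  "S_set G S \<longleftrightarrow> S \<subseteq> {v. special G v} \<and>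
     (\<forall>C \<in> {v. special G v} // special_twin_rel G. \<exists>!v. v \<in> S \<and> v \<in> C)"

subsection \<open>Forbidden induced subgraphs\<close>

definition has_induced_copy :: "'a pair_pre_digraph \<Rightarrow> 'b pair_pre_digraph \<Rightarrow> bool" where
  "has_induced_copy G H \<longleftrightarrow>
     (\<exists>K. induced_subgraph K (with_proj G) \<and> digraph_iso (with_proj H) K)"

definition induced_free :: "'a pair_pre_digraph \<Rightarrow> 'b pair_pre_digraph set \<Rightarrow> bool" where
  "induced_free G \<H> \<longleftrightarrow> (\<forall>H\<in>\<H>. \<not> has_induced_copy G H)"

definition graph_of_edges :: "'a set \<Rightarrow> ('a \<times> 'a) set \<Rightarrow> 'a pair_pre_digraph" where
  "graph_of_edges V E = \<lparr> pverts = V, parcs = E \<union> E\<inverse> \<rparr>"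

text \<open>The cycle of length \<open>k\<close>, for \<open>k \<ge> 3\<close>.\<close>

definition cycle_graph :: "nat \<Rightarrow> nat pair_pre_digraph" where
  "cycle_graph k = graph_of_edges {..<k} {(i, Suc i mod k) | i. i < k}"

text \<open>The vertex \<open>a\<^sub>i\<close> of \<open>H\<^sub>1\<close> and \<open>H\<^sub>2\<close> is the number \<open>i\<close>.\<close>

definition H1_edges :: "(nat \<times> nat) set" where
  "H1_edges = {(1,2), (2,3), (3,4), (4,5), (5,6), (6,1), (2,6)}"

definition H1_graph :: "nat pair_pre_digraph" where
  "H1_graph = graph_of_edges {1..6} H1_edges"

definition H2_graph :: "nat pair_pre_digraph" where
  "H2_graph = graph_of_edges {1..6} (H1_edges \<union> {(3,5)})"

lemma pair_graph_graph_of_edges: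
  assumes "finite V" "E \<subseteq> V \<times> V" "\<And>v. (v, v) \<notin> E"
  shows "pair_graph (graph_of_edges V E)"
proof -
  have "finite E"
    using assms(1,2) by (meson finite_SigmaI finite_subset)
  then show ?thesis
    using assms by unfold_locales (auto simp: graph_of_edges_def symmetric_def sym_def)
qed

lemma pair_graph_H1_graph: "pair_graph H1_graph"
  unfolding H1_graph_def by (rule pair_graph_graph_of_edges) (auto simp: H1_edges_def)

lemma pair_graph_H2_graph: "pair_graph H2_graph"
  unfolding H2_graph_def by (rule pair_graph_graph_of_edges) (auto simp: H1_edges_def)

lemma pair_graph_cycle_graph:
  assumes "k \<ge> 3"
  shows "pair_graph (cycle_graph k)"
proof -
  have "i \<noteq> Suc i mod k" if "i < k" for i
    using assms that by (cases "Suc i = k") auto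
  then show ?thesis
    unfolding cycle_graph_def using assms
    by (intro pair_graph_graph_of_edges) auto
qed

lemma equiv_special_twin_rel: "equiv {v. special G v} (special_twin_rel G)"
  by (auto simp: equiv_def refl_on_def sym_def trans_def special_twin_rel_def true_twins_def)

lemma has_induced_copy_iff:
  assumes G: "pair_wf_digraph G" and H: "pair_wf_digraph H"
  shows "has_induced_copy G H \<longleftrightarrow>
    (\<exists>f. inj_on f (pverts H) \<and> f ` pverts H \<subseteq> pverts G \<and>
      (\<forall>u\<in>pverts H. \<forall>v\<in>pverts H. (f u, f v) \<in> parcs G \<longleftrightarrow> (u, v) \<in> parcs H))"
    (is "_ \<longleftrightarrow> (\<exists>f. ?P f)")
proof
  interpret H: pair_wf_digraph H by fact
  assume "has_induced_copy G H"
  then obtain K h where K: "induced_subgraph K (with_proj G)"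
    and h: "pre_digraph.digraph_isomorphism (with_proj H) h" and Kh: "K = app_iso h (with_proj H)"
    unfolding has_induced_copy_def digraph_iso_def by blast
  define f where "f = iso_verts h"
  have vK: "verts K = f ` pverts H" and aK: "arcs K = iso_arcs h ` parcs H"
    by (simp_all add: Kh f_def)
  have sub: "verts K \<subseteq> pverts G" "compatible (with_proj G) K"
    and ind: "arcs K = {e \<in> parcs G. fst e \<in> verts K \<and> snd e \<in> verts K}"
    using K by (auto simp: induced_subgraph_def subgraph_def)
  have ht: "iso_tail h = fst" "iso_head h = snd"
    using sub(2) by (auto simp: compatible_def Kh)
  have inj: "inj_on f (pverts H)"
    using h by (simp add: pre_digraph.digraph_isomorphism_def f_def)
  have arc: "iso_arcs h (u, v) = (f u, f v)" if "(u, v) \<in> parcs H" for u v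
    using h that by (force simp: pre_digraph.digraph_isomorphism_def f_def ht intro!: prod_eqI)
  have "(f u, f v) \<in> parcs G \<longleftrightarrow> (u, v) \<in> parcs H"
    if "u \<in> pverts H" "v \<in> pverts H" for u v
  proof
    assume "(f u, f v) \<in> parcs G"
    with that have "(f u, f v) \<in> iso_arcs h ` parcs H"
      using ind by (auto simp: vK aK)
    then obtain a b where ab: "(a, b) \<in> parcs H" "(f u, f v) = iso_arcs h (a, b)" by auto
    then have "f u = f a" "f v = f b" by (simp_all add: arc)
    then show "(u, v) \<in> parcs H"
      using inj that ab(1) H.in_arcsD1 H.in_arcsD2 by (metis inj_onD)
  next
    assume "(u, v) \<in> parcs H"
    then have "(f u, f v) \<in> arcs K" using arc by (force simp: aK)
    then show "(f u, f v) \<in> parcs G" by (simp add: ind)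
  qed
  with inj sub(1) show "\<exists>f. ?P f" by (auto simp: vK)
next
  interpret G: pair_wf_digraph G by fact
  interpret H: pair_wf_digraph H by fact
  assume "\<exists>f. ?P f"
  then obtain f where f: "?P f" ..
  define h where "h = \<lparr> iso_verts = f, iso_arcs = map_prod f f,
    iso_head = (snd :: 'a \<times> 'a \<Rightarrow> 'a), iso_tail = fst \<rparr>"
  have iso: "pre_digraph.digraph_isomorphism (with_proj H) h"
    using f H.wf_digraph
    by (auto simp: pre_digraph.digraph_isomorphism_def h_def inj_on_def wf_digraph_wp_iff
        dest: H.in_arcsD1 H.in_arcsD2)
      (meson H H.in_arcsD1 H.in_arcsD2)+
  have wf: "wf_digraph (app_iso h (with_proj H))"
    using iso by (rule H.wf_digraphI_app_iso)
  have arcG: "(f u, f v) \<in> parcs G" if "(u, v) \<in> parcs H" for u v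
    using f that by (meson H.in_arcsD1 H.in_arcsD2)
  have arcH: "(f u, f v) \<in> map_prod f f ` parcs H"
    if "u \<in> pverts H" "v \<in> pverts H" "(f u, f v) \<in> parcs G" for u v
    using f that by force
  have "{e \<in> parcs G. fst e \<in> f ` pverts H \<and> snd e \<in> f ` pverts H} = map_prod f f ` parcs H"
    using arcG arcH by (auto dest: H.in_arcsD1 H.in_arcsD2)
  then have "induced_subgraph (app_iso h (with_proj H)) (with_proj G)"
    unfolding induced_subgraph_def subgraph_def compatible_def
    using f wf G arcG by (auto simp: h_def wf_digraph_wp_iff)
  with iso show "has_induced_copy G H"
    unfolding has_induced_copy_def digraph_iso_def by blast
qed

end

theory Submission
  imports Defs
begin

text \<open>
  If \<open>S\<close> is a packing and dominating, the sets \<open>N[s]\<close> partition the vertices. A total dominating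
  set meeting \<open>N[s]\<close> in a single vertex \<open>u\<close> would have \<open>u \<in> M(s)\<close> and \<open>D(s) \<subseteq> N(u)\<close>, so for
  special \<open>s\<close> it meets \<open>N[s]\<close> at least twice, and \<open>\<gamma>\<^sub>t \<ge> 2|S| \<ge> 2\<gamma>\<close>.

  Conversely, if \<open>\<gamma>\<^sub>t = 2\<gamma>\<close> then every minimum dominating set \<open>A\<close> is a packing. For distinct
  \<open>a, b \<in> A\<close> the forbidden subgraphs force the sets \<open>N(u) \<inter> N(b)\<close>, \<open>u \<in> N(a)\<close>, to form a chain
  under inclusion, so some \<open>w\<^sub>b \<in> N(b)\<close> is adjacent to every vertex of \<open>N(a)\<close> that has a neighbour
  in \<open>N(b)\<close>. If \<open>u\<close> witnesses that \<open>a\<close> is not special, then \<open>u\<close>, \<open>A - {a}\<close> and the \<open>w\<^sub>b\<close> form a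
  total dominating set of size less than \<open>2\<gamma>\<close>. Hence \<open>A\<close> consists of special vertices, and every
  special vertex is a true twin of a vertex of \<open>A\<close>.
\<close>

section \<open>Adjacency and domination, vertex by vertex\<close>

lemma in_nbhd [simp]: "u \<in> nbhd G v \<longleftrightarrow> (v, u) \<in> parcs G"
  by (simp add: nbhd_def)

lemma in_closed_nbhd [simp]: "u \<in> closed_nbhd G v \<longleftrightarrow> u = v \<or> (v, u) \<in> parcs G"
  by (auto simp: closed_nbhd_def)

context pair_graph
begin

lemma adj_sym: "(u, v) \<in> parcs G \<longleftrightarrow> (v, u) \<in> parcs G"
  using arcs_symmetric by blast

lemma adj_irrefl [simp]: "(v, v) \<notin> parcs G"
  using pair_no_loops by force

lemma adj_in_verts: "(u, v) \<in> parcs G \<Longrightarrow> u \<in> pverts G \<and> v \<in> pverts G"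
  using in_arcsD1 in_arcsD2 by blast

text \<open>Closed neighbourhoods of vertices stay inside \<open>pverts G\<close>, so the equality
  of sets in the definition reduces to covering each vertex.\<close>

lemma dominating_set_iff:
  "dominating_set G A \<longleftrightarrow> A \<subseteq> pverts G \<and> (\<forall>v\<in>pverts G. \<exists>a\<in>A. v \<in> closed_nbhd G a)"
proof -
  have eq: "closed_set_nbhd G A = (\<Union>a\<in>A. closed_nbhd G a)"
    by (auto simp: closed_set_nbhd_def set_nbhd_def closed_nbhd_def)
  have "(\<Union>a\<in>A. closed_nbhd G a) \<subseteq> pverts G" if "A \<subseteq> pverts G"
    using that adj_in_verts by auto
  then show ?thesis
    unfolding dominating_set_def eq set_eq_subset[of _ "pverts G"] subset_iff[of "pverts G"] UN_iff
    by (simp add: Ball_def cong: conj_cong)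
qed

lemma total_dominating_set_iff:
  "total_dominating_set G T \<longleftrightarrow> T \<subseteq> pverts G \<and> (\<forall>v\<in>pverts G. \<exists>t\<in>T. (v, t) \<in> parcs G)"
proof -
  have "set_nbhd G T \<subseteq> pverts G"
    using adj_in_verts by (auto simp: set_nbhd_def)
  then show ?thesis
    unfolding total_dominating_set_def set_eq_subset[of _ "pverts G"] subset_iff[of "pverts G"]
    by (simp add: set_nbhd_def Ball_def adj_sym cong: conj_cong)
qed

lemma minimum_dominating_set_exists:
  obtains A where "dominating_set G A" "card A = domination_number G"
proof -
  have "dominating_set G (pverts G)"
    by (auto simp: dominating_set_iff)
  then have "\<exists>k A. dominating_set G A \<and> card A = k" by blast
  from LeastI_ex[OF this] show ?thesis
    using that unfolding domination_number_def by blast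
qed

lemma domination_number_le: "dominating_set G A \<Longrightarrow> domination_number G \<le> card A"
  unfolding domination_number_def by (rule Least_le) blast

lemma total_domination_number_le: "total_dominating_set G T \<Longrightarrow> total_domination_number G \<le> card T"
  unfolding total_domination_number_def by (rule Least_le) blast

lemma dominating_set_finite: "dominating_set G A \<Longrightarrow> finite A"
  unfolding dominating_set_def using pair_finite_verts finite_subset by blast

section \<open>Extending dominating sets to total dominating sets\<close>

lemma neighbour_function:
  assumes "\<nexists>v. isolated G v"
  obtains n where "\<And>v. v \<in> pverts G \<Longrightarrow> (v, n v) \<in> parcs G"
proof -
  have "\<forall>v\<in>pverts G. \<exists>u. (v, u) \<in> parcs G"
    using assms by (auto simp: isolated_def nbhd_def)
  then show ?thesis using that by metis
qed

text \<open>A vertex \<open>v\<close> of \<open>A\<close> is served by its chosen neighbour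
  \<open>n v\<close>, any other vertex by the element of \<open>A\<close> that dominates it.\<close>

lemma total_dominating_set_extend:
  assumes "dominating_set G A" "\<And>v. v \<in> pverts G \<Longrightarrow> (v, n v) \<in> parcs G"
  shows "total_dominating_set G (A \<union> n ` A)"
  unfolding total_dominating_set_iff
proof (intro conjI ballI)
  show "A \<union> n ` A \<subseteq> pverts G"
    using assms adj_in_verts by (auto simp: dominating_set_iff)
  fix v assume v: "v \<in> pverts G"
  then obtain a where "a \<in> A" "v \<in> closed_nbhd G a"
    using assms(1) by (auto simp: dominating_set_iff)
  then show "\<exists>t\<in>A \<union> n ` A. (v, t) \<in> parcs G"
    using assms(2)[OF v] adj_sym by auto
qed

lemma minimum_total_dominating_set_exists:
  assumes "\<nexists>v. isolated G v"
  obtains T where "total_dominating_set G T" "card T = total_domination_number G"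
proof -
  obtain n where "\<And>v. v \<in> pverts G \<Longrightarrow> (v, n v) \<in> parcs G"
    using neighbour_function[OF assms] by blast
  then have "\<exists>k T. total_dominating_set G T \<and> card T = k"
    using total_dominating_set_extend minimum_dominating_set_exists by metis
  from LeastI_ex[OF this] show ?thesis
    using that unfolding total_domination_number_def by blast
qed

lemma total_domination_number_le_double:
  assumes "\<nexists>v. isolated G v"
  shows "total_domination_number G \<le> 2 * domination_number G"
proof -
  obtain n where n: "\<And>v. v \<in> pverts G \<Longrightarrow> (v, n v) \<in> parcs G"
    using neighbour_function[OF assms] by blast
  obtain A where A: "dominating_set G A" "card A = domination_number G"
    using minimum_dominating_set_exists .
  have "total_domination_number G \<le> card (A \<union> n ` A)"
    using total_dominating_set_extend[OF A(1)] n by (intro total_domination_number_le) blast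
  also have "\<dots> \<le> card A + card (n ` A)" by (rule card_Un_le)
  also have "\<dots> \<le> 2 * card A"
    using card_image_le[OF dominating_set_finite[OF A(1)], of n] by simp
  finally show ?thesis using A(2) by simp
qed

text \<open>A common element \<open>z\<close> of \<open>N[u]\<close> and \<open>N[v]\<close> would
  serve both \<open>u\<close> and \<open>v\<close>. Giving each other element of \<open>A\<close>
  its own neighbour then yields a total dominating set with at most \<open>2|A| - 1\<close>
  elements.\<close>

lemma minimum_dominating_set_packing:
  assumes G: "gammat_2gamma_graph G"
    and A: "dominating_set G A" "card A = domination_number G"
  shows "packing G A"
proof (rule ccontr)
  have AV: "A \<subseteq> pverts G" and fin: "finite A"
    using A(1) dominating_set_finite by (auto simp: dominating_set_iff)
  assume "\<not> packing G A"
  then obtain u v z where uv: "u \<in> A" "v \<in> A" "u \<noteq> v"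
    and z: "z \<in> closed_nbhd G u" "z \<in> closed_nbhd G v"
    using AV unfolding packing_def by blast
  obtain n where n: "\<And>v. v \<in> pverts G \<Longrightarrow> (v, n v) \<in> parcs G"
    using neighbour_function G unfolding gammat_2gamma_graph_def by blast
  define T where "T = insert z (A \<union> n ` (A - {u, v}))"
  have "total_dominating_set G T"
    unfolding total_dominating_set_iff
  proof (intro conjI ballI)
    show "T \<subseteq> pverts G"
      using AV n uv z adj_in_verts unfolding T_def by (auto simp: subset_iff)
    fix x assume x: "x \<in> pverts G"
    then obtain a where a: "a \<in> A" "x \<in> closed_nbhd G a"
      using A(1) by (auto simp: dominating_set_iff)
    \<comment> \<open>If \<open>z\<close> is \<open>u\<close> or \<open>v\<close> itself, then
      \<open>u\<close> and \<open>v\<close> are adjacent and each serves the other.\<close>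
    consider "x \<in> A - {u, v}" | "x = u" | "x = v" | "(x, a) \<in> parcs G"
      using a adj_sym by auto
    then show "\<exists>t\<in>T. (x, t) \<in> parcs G"
      using n[OF x] uv z a(1) adj_sym unfolding T_def by cases auto
  qed
  then have "total_domination_number G \<le> card T" by (rule total_domination_number_le)
  also have "card T \<le> Suc (card (A \<union> n ` (A - {u, v})))"
    unfolding T_def using fin by (simp add: card_insert_if)
  also have "card (A \<union> n ` (A - {u, v})) \<le> card A + card (n ` (A - {u, v}))"
    by (rule card_Un_le)
  also have "card (n ` (A - {u, v})) \<le> card (A - {u, v})"
    using fin by (intro card_image_le) auto
  also have "card (A - {u, v}) = card A - 2"
    using uv fin by (simp add: card_Diff_subset)
  finally have "total_domination_number G \<le> Suc (card A + (card A - 2))" by simp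
  \<comment> \<open>Subtraction on naturals truncates, so this bound is needed to read the estimate
    as \<open>2|A| - 1\<close>.\<close>
  moreover have "card A \<ge> 2"
    using card_mono[OF fin, of "{u, v}"] uv by simp
  ultimately show False
    using G A(2) unfolding gammat_2gamma_graph_def by linarith
qed

section \<open>Forbidden induced subgraphs and chains of neighbourhoods\<close>

text \<open>Symmetry and irreflexivity on both sides leave only the pairs \<open>j < k\<close> to
  compare. The offset \<open>i\<close> is there because the vertices of \<open>H1_graph\<close> and
  \<open>H2_graph\<close> start at 1, those of \<open>cycle_graph\<close> at 0.\<close>

lemma induced_copyI:
  assumes H: "pair_graph H"
    and V: "pverts H = {i..<i + length vs}" and "distinct vs" "set vs \<subseteq> pverts G"
    and arcs: "\<forall>k<length vs. \<forall>j<k. (vs ! j, vs ! k) \<in> parcs G \<longleftrightarrow> (i + j, i + k) \<in> parcs H"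
  shows "has_induced_copy G H"
proof -
  interpret H: pair_graph H by fact
  define f where "f = (\<lambda>j. vs ! (j - i))"
  have "(vs ! j, vs ! k) \<in> parcs G \<longleftrightarrow> (i + j, i + k) \<in> parcs H"
    if "j < length vs" "k < length vs" for j k
    using arcs that adj_sym H.adj_sym adj_irrefl H.adj_irrefl
    by (cases j k rule: linorder_cases) fastforce+
  then have "(f j, f k) \<in> parcs G \<longleftrightarrow> (j, k) \<in> parcs H"
    if "j \<in> pverts H" "k \<in> pverts H" for j k
    using that unfolding V f_def
    by (metis add.commute add_diff_inverse_nat atLeastLessThan_iff less_diff_conv2 linorder_not_less)
  moreover have "inj_on f (pverts H)"
    using \<open>distinct vs\<close> by (auto simp: V f_def inj_on_def nth_eq_iff_index_eq)
  moreover have "f ` pverts H \<subseteq> pverts G"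
    using \<open>set vs \<subseteq> pverts G\<close> by (auto simp: V f_def subset_iff)
  ultimately show ?thesis
    unfolding has_induced_copy_iff[OF pair_wf_digraph_axioms H.pair_wf_digraph_axioms] by blast
qed

lemma less_6_cases: "(k::nat) < 6 \<Longrightarrow> k = 0 \<or> k = 1 \<or> k = 2 \<or> k = 3 \<or> k = 4 \<or> k = 5"
  by linarith

text \<open>All fifteen pairs are prescribed, each with the smaller index first, which is the
  orientation compared in \<open>induced_copyI\<close>.\<close>

lemma induced_copy_H1:
  assumes "distinct [a1, a2, a3, a4, a5, a6]"
    and "(a1, a2) \<in> parcs G" "(a2, a3) \<in> parcs G" "(a3, a4) \<in> parcs G"
      "(a4, a5) \<in> parcs G" "(a5, a6) \<in> parcs G" "(a1, a6) \<in> parcs G" "(a2, a6) \<in> parcs G"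
    and "(a1, a3) \<notin> parcs G" "(a1, a4) \<notin> parcs G" "(a1, a5) \<notin> parcs G"
      "(a2, a4) \<notin> parcs G" "(a2, a5) \<notin> parcs G" "(a3, a5) \<notin> parcs G"
      "(a3, a6) \<notin> parcs G" "(a4, a6) \<notin> parcs G"
  shows "has_induced_copy G H1_graph"
proof (rule induced_copyI[OF pair_graph_H1_graph, of 1 "[a1, a2, a3, a4, a5, a6]"])
  show "set [a1, a2, a3, a4, a5, a6] \<subseteq> pverts G"
    using assms adj_in_verts by auto
  show "pverts H1_graph = {1..<1 + length [a1, a2, a3, a4, a5, a6]}"
    by (auto simp: H1_graph_def graph_of_edges_def)
  show "\<forall>k<length [a1, a2, a3, a4, a5, a6]. \<forall>j<k.
      ([a1, a2, a3, a4, a5, a6] ! j, [a1, a2, a3, a4, a5, a6] ! k) \<in> parcs G \<longleftrightarrow>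
      (1 + j, 1 + k) \<in> parcs H1_graph"
    by (simp add: All_less_Suc assms)
      (simp add: H1_graph_def H1_edges_def graph_of_edges_def)
qed (fact assms(1))

lemma induced_copy_H2:
  assumes "distinct [a1, a2, a3, a4, a5, a6]"
    and "(a1, a2) \<in> parcs G" "(a2, a3) \<in> parcs G" "(a3, a4) \<in> parcs G"
      "(a4, a5) \<in> parcs G" "(a5, a6) \<in> parcs G" "(a1, a6) \<in> parcs G" "(a2, a6) \<in> parcs G"
      "(a3, a5) \<in> parcs G"
    and "(a1, a3) \<notin> parcs G" "(a1, a4) \<notin> parcs G" "(a1, a5) \<notin> parcs G"
      "(a2, a4) \<notin> parcs G" "(a2, a5) \<notin> parcs G"
      "(a3, a6) \<notin> parcs G" "(a4, a6) \<notin> parcs G"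
  shows "has_induced_copy G H2_graph"
proof (rule induced_copyI[OF pair_graph_H2_graph, of 1 "[a1, a2, a3, a4, a5, a6]"])
  show "set [a1, a2, a3, a4, a5, a6] \<subseteq> pverts G"
    using assms adj_in_verts by auto
  show "pverts H2_graph = {1..<1 + length [a1, a2, a3, a4, a5, a6]}"
    by (auto simp: H2_graph_def graph_of_edges_def)
  show "\<forall>k<length [a1, a2, a3, a4, a5, a6]. \<forall>j<k.
      ([a1, a2, a3, a4, a5, a6] ! j, [a1, a2, a3, a4, a5, a6] ! k) \<in> parcs G \<longleftrightarrow>
      (1 + j, 1 + k) \<in> parcs H2_graph"
    by (simp add: All_less_Suc assms)
      (simp add: H2_graph_def H1_edges_def graph_of_edges_def)
qed (fact assms(1))

lemma induced_copy_C6: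
  assumes "distinct [a1, a2, a3, a4, a5, a6]"
    and "(a1, a2) \<in> parcs G" "(a2, a3) \<in> parcs G" "(a3, a4) \<in> parcs G"
      "(a4, a5) \<in> parcs G" "(a5, a6) \<in> parcs G" "(a1, a6) \<in> parcs G"
    and "(a1, a3) \<notin> parcs G" "(a1, a4) \<notin> parcs G" "(a1, a5) \<notin> parcs G"
      "(a2, a4) \<notin> parcs G" "(a2, a5) \<notin> parcs G" "(a2, a6) \<notin> parcs G"
      "(a3, a5) \<notin> parcs G" "(a3, a6) \<notin> parcs G" "(a4, a6) \<notin> parcs G"
  shows "has_induced_copy G (cycle_graph 6)"
proof (rule induced_copyI[of _ 0 "[a1, a2, a3, a4, a5, a6]"])
  show "pair_graph (cycle_graph 6)" by (rule pair_graph_cycle_graph) simp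
  show "set [a1, a2, a3, a4, a5, a6] \<subseteq> pverts G"
    using assms adj_in_verts by auto
  have edges: "{(i, Suc i mod 6) |i. i < 6} = {(0, 1), (1, 2), (2, 3), (3, 4), (4, 5), (5, 0)}"
    by (auto dest!: less_6_cases)
  show "\<forall>k<length [a1, a2, a3, a4, a5, a6]. \<forall>j<k.
      ([a1, a2, a3, a4, a5, a6] ! j, [a1, a2, a3, a4, a5, a6] ! k) \<in> parcs G \<longleftrightarrow>
      (0 + j, 0 + k) \<in> parcs (cycle_graph 6)"
    unfolding cycle_graph_def edges by (simp add: All_less_Suc assms) (simp add: graph_of_edges_def)
  show "pverts (cycle_graph 6) = {0..<0 + length [a1, a2, a3, a4, a5, a6]}"
    by (auto simp: cycle_graph_def graph_of_edges_def)
qed (fact assms(1))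

text \<open>If \<open>w \<in> N(u) - N(x)\<close> and \<open>y \<in> N(x) - N(u)\<close> in \<open>N(b)\<close>, then \<open>a u w b y x\<close> is a 6-cycle whose
  only possible chords are \<open>ux\<close> and \<open>wy\<close>.\<close>

lemma nbhd_chain:
  assumes free: "induced_free G {H1_graph, H2_graph, cycle_graph 6}"
    and disj: "closed_nbhd G a \<inter> closed_nbhd G b = {}"
    and "u \<in> nbhd G a" "x \<in> nbhd G a"
  shows "nbhd G u \<inter> nbhd G b \<subseteq> nbhd G x \<or> nbhd G x \<inter> nbhd G b \<subseteq> nbhd G u"
proof (rule ccontr)
  assume "\<not> ?thesis"
  then obtain w y where "w \<in> nbhd G u \<inter> nbhd G b - nbhd G x" "y \<in> nbhd G x \<inter> nbhd G b - nbhd G u"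
    by blast
  then have w: "(u, w) \<in> parcs G" "(b, w) \<in> parcs G" "(x, w) \<notin> parcs G"
    and y: "(x, y) \<in> parcs G" "(b, y) \<in> parcs G" "(u, y) \<notin> parcs G"
    by auto
  have ux: "(a, u) \<in> parcs G" "(a, x) \<in> parcs G" using assms by auto
  \<comment> \<open>Disjointness excludes every coincidence and every chord of the hexagon that
    involves \<open>a\<close> or \<open>b\<close>; the choice of \<open>w\<close> and
    \<open>y\<close> excludes \<open>xw\<close> and \<open>uy\<close>.\<close>
  have "v \<notin> closed_nbhd G b" if "v \<in> closed_nbhd G a" for v
    using disj that by blast
  then have sep: "a \<noteq> b" "u \<noteq> b" "x \<noteq> b" "a \<noteq> w" "a \<noteq> y" "u \<noteq> w" "u \<noteq> y" "x \<noteq> w" "x \<noteq> y"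
    "(a, b) \<notin> parcs G" "(b, a) \<notin> parcs G" "(b, u) \<notin> parcs G" "(b, x) \<notin> parcs G"
    "(a, w) \<notin> parcs G" "(a, y) \<notin> parcs G"
    using w y ux by auto
  have dist: "u \<noteq> x" "w \<noteq> y" "a \<noteq> u" "a \<noteq> x" "b \<noteq> w" "b \<noteq> y"
    using w y ux by auto
  note facts = w y ux sep dist
  have facts': "(w, u) \<in> parcs G" "(w, b) \<in> parcs G" "(w, x) \<notin> parcs G" "(y, x) \<in> parcs G"
    "(y, b) \<in> parcs G" "(y, u) \<notin> parcs G" "(u, a) \<in> parcs G" "(x, a) \<in> parcs G"
    "(u, b) \<notin> parcs G" "(x, b) \<notin> parcs G" "(w, a) \<notin> parcs G" "(y, a) \<notin> parcs G"
    using facts by (simp_all add: adj_sym)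
  have "has_induced_copy G H1_graph \<or> has_induced_copy G H2_graph
      \<or> has_induced_copy G (cycle_graph 6)"
  proof (cases "(u, x) \<in> parcs G"; cases "(w, y) \<in> parcs G")
    assume "(u, x) \<in> parcs G" "(w, y) \<in> parcs G"
    then have "has_induced_copy G H2_graph"
      using facts facts' by (intro induced_copy_H2[of a u w b y x]) auto
    then show ?thesis by blast
  next
    assume "(u, x) \<in> parcs G" "(w, y) \<notin> parcs G"
    then have "has_induced_copy G H1_graph"
      using facts facts' by (intro induced_copy_H1[of a u w b y x]) auto
    then show ?thesis by blast
  next
    assume "(u, x) \<notin> parcs G" "(w, y) \<in> parcs G"
    then have "has_induced_copy G H1_graph"
      \<comment> \<open>Starting the hexagon at \<open>b\<close> puts its only chord
        \<open>wy\<close> in the place of the chord between the second and sixth vertices.\<close>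
      using facts facts' by (intro induced_copy_H1[of b w u a x y]) auto
    then show ?thesis by blast
  next
    assume "(u, x) \<notin> parcs G" "(w, y) \<notin> parcs G"
    then have "has_induced_copy G (cycle_graph 6)"
      using facts facts' by (intro induced_copy_C6[of a u w b y x]) auto
    then show ?thesis by blast
  qed
  then show False using free by (auto simp: induced_free_def)
qed

text \<open>The nonempty sets among the \<open>N(u) \<inter> N(b)\<close> form a finite chain, and
  any \<open>w\<close> in the least of them works. If there are none, any neighbour of
  \<open>b\<close> does.\<close>

lemma common_neighbour:
  assumes free: "induced_free G {H1_graph, H2_graph, cycle_graph 6}"
    and disj: "closed_nbhd G a \<inter> closed_nbhd G b = {}"
    and b: "nbhd G b \<noteq> {}"
  shows "\<exists>w\<in>nbhd G b. \<forall>u\<in>nbhd G a. nbhd G u \<inter> nbhd G b \<noteq> {} \<longrightarrow> (u, w) \<in> parcs G"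
proof -
  define F where "F = {u \<in> nbhd G a. nbhd G u \<inter> nbhd G b \<noteq> {}}"
  have fin: "finite (nbhd G v)" for v
    by (rule finite_subset[OF _ pair_finite_verts]) (auto dest: adj_in_verts)
  show ?thesis
  proof (cases "F = {}")
    case True
    then show ?thesis using b unfolding F_def by blast
  next
    case False
    \<comment> \<open>Least cardinality is used to find the least set: in a chain of finite sets a
      member of least size lies in all others.\<close>
    then obtain u where u: "u \<in> F"
      "\<And>x. x \<in> F \<Longrightarrow> card (nbhd G u \<inter> nbhd G b) \<le> card (nbhd G x \<inter> nbhd G b)"
      using ex_has_least_nat[of "\<lambda>x. x \<in> F" _ "\<lambda>x. card (nbhd G x \<inter> nbhd G b)"] by blast
    have "nbhd G u \<inter> nbhd G b \<subseteq> nbhd G x" if "x \<in> F" for x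
    proof -
      have "u \<in> nbhd G a" "x \<in> nbhd G a" using u(1) that by (simp_all add: F_def)
      from nbhd_chain[OF free disj this] show ?thesis
      proof
        assume "nbhd G x \<inter> nbhd G b \<subseteq> nbhd G u"
        then have "nbhd G x \<inter> nbhd G b = nbhd G u \<inter> nbhd G b"
          using u(2)[OF that] fin by (intro card_seteq) auto
        then show ?thesis by blast
      qed blast
    qed
    moreover obtain w where "w \<in> nbhd G u \<inter> nbhd G b"
      using u unfolding F_def by blast
    ultimately have "w \<in> nbhd G b" "\<forall>x\<in>F. w \<in> nbhd G x" by blast+
    then show ?thesis by (intro bexI[of _ w] ballI impI) (simp_all add: F_def)
  qed
qed

section \<open>Special vertices and minimum dominating sets\<close>

lemma minimum_dominating_set_special:
  assumes G: "gammat_2gamma_graph G"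
    and free: "induced_free G {H1_graph, H2_graph, cycle_graph 6}"
    and A: "dominating_set G A" "card A = domination_number G"
    and a: "a \<in> A"
  shows "special G a"
proof (rule ccontr)
  have AV: "A \<subseteq> pverts G" and fin: "finite A"
    using A(1) dominating_set_finite by (auto simp: dominating_set_iff)
  have noiso: "\<nexists>v. isolated G v"
    using G by (simp add: gammat_2gamma_graph_def)
  have disj: "closed_nbhd G b \<inter> closed_nbhd G c = {}" if "b \<in> A" "c \<in> A" "b \<noteq> c" for b c
    using minimum_dominating_set_packing[OF G A] that by (auto simp: packing_def)
  assume "\<not> special G a"
  then obtain u where u: "u \<in> M_set G a" "D_set G a \<subseteq> nbhd G u"
    using a AV noiso unfolding special_def by blast
  have "\<exists>w\<in>nbhd G b. \<forall>x\<in>nbhd G a. nbhd G x \<inter> nbhd G b \<noteq> {} \<longrightarrow> (x, w) \<in> parcs G"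
    if "b \<in> A - {a}" for b
  proof (rule common_neighbour[OF free disj])
    show "nbhd G b \<noteq> {}" using noiso AV that by (auto simp: isolated_def)
  qed (use that a in auto)
  then obtain w where w: "\<And>b. b \<in> A - {a} \<Longrightarrow> (b, w b) \<in> parcs G"
    "\<And>b x. b \<in> A - {a} \<Longrightarrow> (a, x) \<in> parcs G \<Longrightarrow> nbhd G x \<inter> nbhd G b \<noteq> {}
      \<Longrightarrow> (x, w b) \<in> parcs G"
    unfolding in_nbhd by (metis in_nbhd)
  have au: "(a, u) \<in> parcs G" using u by (simp add: M_set_def)
  \<comment> \<open>Leaving out \<open>a\<close> and its partner and adding \<open>u\<close> gives
    at most \<open>2(|A| - 1) + 1\<close> elements, one below \<open>2\<gamma>\<close>.\<close>
  define T where "T = insert u ((A - {a}) \<union> w ` (A - {a}))"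
  have "total_dominating_set G T"
    unfolding total_dominating_set_iff
  proof (intro conjI ballI)
    show "T \<subseteq> pverts G"
      using AV au w(1) adj_in_verts unfolding T_def by auto
    fix x assume x: "x \<in> pverts G"
    then obtain b where b: "b \<in> A" "x \<in> closed_nbhd G b"
      using A(1) by (auto simp: dominating_set_iff)
    show "\<exists>t\<in>T. (x, t) \<in> parcs G"
    proof (cases "b = a")
      case False
      then show ?thesis
        using b w(1)[of b] adj_sym[of x b] unfolding T_def by auto
    next
      case True
      \<comment> \<open>This is the partition of \<open>N[a]\<close> into \<open>T(a)\<close>,
        \<open>D(a)\<close> and \<open>M(a)\<close>: \<open>u\<close> serves the first two parts,
        the \<open>w c\<close> serve the third.\<close>
      consider "closed_nbhd G x = closed_nbhd G a" | "x \<in> D_set G a" | "x \<in> M_set G a"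
      proof (cases "closed_nbhd G x \<subseteq> closed_nbhd G a")
        case sub: True
        have "x = a \<or> x \<in> nbhd G a" using b True by auto
        then show ?thesis using sub that unfolding D_set_def by blast
      next
        case False
        then obtain y where "y \<in> closed_nbhd G x" "y \<notin> closed_nbhd G a" by blast
        moreover from this b True have "y \<in> nbhd G x" "x \<in> nbhd G a" by auto
        ultimately show ?thesis using that unfolding M_set_def by blast
      qed
      then show ?thesis
      proof cases
        case 1
        then have "x = u \<or> (x, u) \<in> parcs G" using au by auto
        \<comment> \<open>\<open>u\<close> has a neighbour outside \<open>N[a]\<close>, which a true
          twin of \<open>a\<close> cannot have.\<close>
        moreover have "x \<noteq> u"
          using u(1) 1 unfolding M_set_def by auto
        ultimately show ?thesis unfolding T_def by blast
      next
        case 2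
        then have "(x, u) \<in> parcs G" using u(2) adj_sym by auto
        then show ?thesis unfolding T_def by blast
      next
        case 3
        then obtain y where y: "(a, x) \<in> parcs G" "(x, y) \<in> parcs G" "y \<notin> closed_nbhd G a"
          by (auto simp: M_set_def)
        then obtain c where c: "c \<in> A" "y \<in> closed_nbhd G c"
          using A(1) adj_in_verts by (meson dominating_set_iff)
        have ca: "c \<in> A - {a}" using c y by auto
        \<comment> \<open>As \<open>A\<close> is a packing, \<open>x\<close> is not adjacent to
          \<open>c\<close>. Hence \<open>y\<close> differs from \<open>c\<close> and is a common
          neighbour of \<open>x\<close> and \<open>c\<close>, which makes \<open>w c\<close>
          adjacent to \<open>x\<close>.\<close>
        have "x \<notin> closed_nbhd G c"
          using disj[of a c] a c ca y(1) by auto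
        then have "y \<noteq> c"
          using y adj_sym[of x c] by auto
        then have "(x, w c) \<in> parcs G"
          using c y by (intro w(2)[OF ca]) auto
        then show ?thesis using ca unfolding T_def by blast
      qed
    qed
  qed
  then have "total_domination_number G \<le> card T" by (rule total_domination_number_le)
  also have "card T \<le> Suc (card ((A - {a}) \<union> w ` (A - {a})))"
    unfolding T_def by (simp add: card_insert_if fin)
  also have "card ((A - {a}) \<union> w ` (A - {a})) \<le> card (A - {a}) + card (w ` (A - {a}))"
    by (rule card_Un_le)
  also have "card (w ` (A - {a})) \<le> card (A - {a})"
    using fin by (intro card_image_le) auto
  finally have "total_domination_number G \<le> Suc (card (A - {a}) + card (A - {a}))" by simp
  moreover have "card A = Suc (card (A - {a}))"
    using a fin by (metis card.remove)
  ultimately show False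
    using G A(2) unfolding gammat_2gamma_graph_def by linarith
qed

text \<open>Let \<open>a\<close> in \<open>A\<close> dominate \<open>v\<close> without being a twin
  of it. Playing the specialness of \<open>a\<close> and of \<open>v\<close> against each other
  gives \<open>d\<close> in \<open>D(v)\<close> outside \<open>N[a]\<close>. Its dominator
  \<open>b\<close> in \<open>A\<close> lies in \<open>N[d]\<close>, hence in \<open>N[v]\<close>, so
  \<open>v\<close> is in both \<open>N[a]\<close> and \<open>N[b]\<close>, against the
  packing.\<close>

lemma special_true_twin:
  assumes A: "dominating_set G A" "packing G A" "\<And>a. a \<in> A \<Longrightarrow> special G a"
    and v: "special G v"
  shows "\<exists>a\<in>A. closed_nbhd G v = closed_nbhd G a"
proof (rule ccontr)
  assume no: "\<not> ?thesis"
  obtain a where a: "a \<in> A" "v \<in> closed_nbhd G a"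
    using A(1) v by (auto simp: dominating_set_iff special_def)
  with no have av: "(a, v) \<in> parcs G" "(v, a) \<in> parcs G" using adj_sym by auto
  have disj: "closed_nbhd G a \<inter> closed_nbhd G b = {}" if "b \<in> A" "b \<noteq> a" for b
    using A(2) a(1) that by (auto simp: packing_def)
  have D: "\<exists>d\<in>D_set G x. d \<notin> nbhd G y" if "special G x" "y \<in> M_set G x" for x y
    using that unfolding special_def by blast
  have sub: "D_set G x \<subseteq> closed_nbhd G x" for x
    by (auto simp: D_set_def)
  \<comment> \<open>Otherwise \<open>N[v]\<close> is strictly inside \<open>N[a]\<close>, so
    \<open>a\<close> is in \<open>M(v)\<close> and \<open>D(v) \<subseteq> N(a)\<close>, and
    \<open>v\<close> is not special.\<close>
  have "v \<in> M_set G a"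
  proof (rule ccontr)
    assume "v \<notin> M_set G a"
    then have strict: "closed_nbhd G v \<subset> closed_nbhd G a"
      using no a av by (auto simp: M_set_def Ball_def)
    then have "a \<in> M_set G v" using av by (auto simp: M_set_def)
    from D[OF v this] obtain d where d: "d \<in> D_set G v" "d \<notin> nbhd G a" by blast
    then have "d \<in> closed_nbhd G a" using strict sub by blast
    then have "d = a" using d by simp
    then show False using d strict by (auto simp: D_set_def)
  qed
  from D[OF A(3)[OF a(1)] this] obtain e where "e \<in> D_set G a" "e \<notin> nbhd G v" by blast
  then have e: "(a, e) \<in> parcs G" "(v, e) \<notin> parcs G" "e \<noteq> v"
    using \<open>v \<in> M_set G a\<close> by (auto simp: D_set_def M_set_def)
  then have "a \<in> M_set G v" using av by (auto simp: M_set_def)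
  from D[OF v this] obtain d where d: "d \<in> D_set G v" "d \<notin> nbhd G a" by blast
  then have dv: "(v, d) \<in> parcs G" "closed_nbhd G d \<subset> closed_nbhd G v"
    by (auto simp: D_set_def)
  \<comment> \<open>\<open>e\<close> lies in \<open>N[a]\<close> but not in \<open>N[v]\<close>,
    which contains \<open>N[d]\<close>.\<close>
  have "d \<noteq> a"
    using dv(2) e by auto
  obtain b where b: "b \<in> A" "d \<in> closed_nbhd G b"
    using A(1) dv adj_in_verts by (meson dominating_set_iff)
  then have "b \<in> closed_nbhd G d" using adj_sym by auto
  then have "b \<in> closed_nbhd G v" using dv(2) by blast
  then have "v \<in> closed_nbhd G b" using adj_sym by auto
  moreover have "b \<noteq> a" using b d \<open>d \<noteq> a\<close> by auto
  ultimately show False using disj[OF b(1)] a(2) by blast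
qed

section \<open>A lower bound for total dominating sets\<close>

lemma total_dominating_set_card_ge:
  assumes S: "packing G S" "dominating_set G S" "\<And>s. s \<in> S \<Longrightarrow> special G s"
    and T: "total_dominating_set G T"
  shows "2 * card S \<le> card T"
proof -
  have fin: "finite T" "finite S"
    using T S(2) dominating_set_finite finite_subset[OF _ pair_finite_verts]
    unfolding total_dominating_set_def by blast+
  have two: "2 \<le> card (T \<inter> closed_nbhd G s)" if s: "s \<in> S" for s
  proof (rule ccontr)
    assume less: "\<not> ?thesis"
    have sV: "s \<in> pverts G" using S(3)[OF s] by (simp add: special_def)
    then obtain u where u: "u \<in> T" "(s, u) \<in> parcs G"
      using T by (auto simp: total_dominating_set_iff)
    have uniq: "t = u" if "t \<in> T" "t \<in> closed_nbhd G s" for t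
    proof (rule ccontr)
      assume "t \<noteq> u"
      then have "card {t, u} \<le> card (T \<inter> closed_nbhd G s)"
        using u that fin by (intro card_mono) auto
      then show False using less \<open>t \<noteq> u\<close> by simp
    qed
    \<comment> \<open>\<open>u\<close> itself needs a neighbour in \<open>T\<close>; as
      \<open>u\<close> is the only element of \<open>T\<close> in \<open>N[s]\<close>, that
      neighbour lies outside.\<close>
    obtain w where w: "w \<in> T" "(u, w) \<in> parcs G"
      using T u adj_in_verts by (meson total_dominating_set_iff)
    then have "w \<notin> closed_nbhd G s" using uniq[of w] by auto
    then have "u \<in> M_set G s" using u w by (auto simp: M_set_def)
    moreover have "D_set G s \<subseteq> nbhd G u"
    proof
      fix d assume d: "d \<in> D_set G s"
      then have "d \<in> pverts G" using adj_in_verts by (auto simp: D_set_def)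
      then obtain t where t: "t \<in> T" "(d, t) \<in> parcs G"
        using T by (auto simp: total_dominating_set_iff)
      \<comment> \<open>\<open>N[d]\<close> is contained in \<open>N[s]\<close>, so whatever serves
        \<open>d\<close> must be \<open>u\<close>.\<close>
      then have "t \<in> closed_nbhd G s" using d by (auto simp: D_set_def)
      then show "d \<in> nbhd G u" using uniq t adj_sym by auto
    qed
    ultimately show False using S(3)[OF s] unfolding special_def by blast
  qed
  have "2 * card S = (\<Sum>s\<in>S. 2)" by simp
  also have "\<dots> \<le> (\<Sum>s\<in>S. card (T \<inter> closed_nbhd G s))" using two by (rule sum_mono)
  \<comment> \<open>The packing property makes the sets \<open>T \<inter> N[s]\<close> disjoint, so
    their sizes add up.\<close>
  also have "\<dots> = card (\<Union>s\<in>S. T \<inter> closed_nbhd G s)"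
    using fin S(1) by (intro card_UN_disjoint[symmetric]) (auto simp: packing_def)
  also have "\<dots> \<le> card T" using fin by (intro card_mono) auto
  finally show ?thesis .
qed

end

theorem theorem2p1:
  fixes G :: "'a pair_pre_digraph" and S :: "'a set"
  assumes "pair_graph G"
    and "pverts G \<noteq> {}"
    and "induced_free G {H1_graph, H2_graph, cycle_graph 6}"
    and "S_set G S"
  shows "gammat_2gamma_graph G \<longleftrightarrow> packing G S \<and> dominating_set G S"
proof
  interpret pair_graph G by fact
  have spec: "special G s" if "s \<in> S" for s
    using assms(4) that by (auto simp: S_set_def)
  \<comment> \<open>The condition on quotient classes becomes a statement about single vertices:
    \<open>S\<close> holds exactly one twin of each special vertex.\<close>
  have transversal: "\<exists>!s. s \<in> S \<and> closed_nbhd G v = closed_nbhd G s" if "special G v" for v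
  proof -
    have "special_twin_rel G `` {v} \<in> {v. special G v} // special_twin_rel G"
      using that by (auto intro: quotientI)
    then have "\<exists>!s. s \<in> S \<and> s \<in> special_twin_rel G `` {v}"
      using assms(4) unfolding S_set_def by blast
    then show ?thesis
      using that spec by (auto simp: special_twin_rel_def true_twins_def)
  qed
  {
    assume G: "gammat_2gamma_graph G"
    obtain A where A: "dominating_set G A" "card A = domination_number G"
      using minimum_dominating_set_exists .
    have pack: "packing G A"
      using minimum_dominating_set_packing[OF G A] .
    have specA: "special G a" if "a \<in> A" for a
      using minimum_dominating_set_special[OF G assms(3) A that] .
    have SV: "S \<subseteq> pverts G" using spec by (auto simp: special_def)
    have "packing G S"
      unfolding packing_def
    proof (intro conjI ballI impI)
      fix s t assume st: "s \<in> S" "t \<in> S" "s \<noteq> t"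
      obtain a where a: "a \<in> A" "closed_nbhd G s = closed_nbhd G a"
        using special_true_twin[OF A(1) pack specA spec[OF st(1)]] by blast
      obtain b where b: "b \<in> A" "closed_nbhd G t = closed_nbhd G b"
        using special_true_twin[OF A(1) pack specA spec[OF st(2)]] by blast
      \<comment> \<open>If \<open>a = b\<close>, then \<open>s\<close> and \<open>t\<close> would be
        two twins in \<open>S\<close>.\<close>
      have "a \<noteq> b" using transversal[OF spec[OF st(1)]] st a b by auto
      then show "closed_nbhd G s \<inter> closed_nbhd G t = {}"
        using pack a b by (simp add: packing_def)
    qed (rule SV)
    moreover have "dominating_set G S"
      unfolding dominating_set_iff
    proof (intro conjI ballI)
      fix v assume "v \<in> pverts G"
      then obtain a where a: "a \<in> A" "v \<in> closed_nbhd G a"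
        using A(1) by (auto simp: dominating_set_iff)
      then show "\<exists>s\<in>S. v \<in> closed_nbhd G s"
        using transversal[OF specA[OF a(1)]] by metis
    qed (rule SV)
    ultimately show "packing G S \<and> dominating_set G S" ..
  next
    assume S: "packing G S \<and> dominating_set G S"
    have noiso: "\<nexists>v. isolated G v"
    proof
      assume "\<exists>v. isolated G v"
      then obtain v where v: "isolated G v" by blast
      then obtain s where s: "s \<in> S" "v \<in> closed_nbhd G s"
        using S by (auto simp: isolated_def dominating_set_iff)
      \<comment> \<open>An isolated vertex can only be dominated by itself, but no element of
        \<open>S\<close> is isolated.\<close>
      with v have "s = v" using adj_sym by (auto simp: isolated_def nbhd_def)
      then show False using spec[OF s(1)] v by (simp add: special_def)
    qed
    obtain T where T: "total_dominating_set G T" "card T = total_domination_number G"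
      using minimum_total_dominating_set_exists[OF noiso] .
    have "2 * card S \<le> total_domination_number G"
      using total_dominating_set_card_ge[OF _ _ spec T(1)] S T(2) by simp
    moreover have "domination_number G \<le> card S"
      using S by (simp add: domination_number_le)
    \<comment> \<open>The chain
      \<open>2\<gamma> \<le> 2|S| \<le> \<gamma>\<^sub>t \<le> 2\<gamma>\<close> collapses to
      equalities.\<close>
    ultimately show "gammat_2gamma_graph G"
      using total_domination_number_le_double[OF noiso] noiso
      by (simp add: gammat_2gamma_graph_def)
  }
qed

end
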